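(* Let $T\in \mathcal{B}_A(\mathcal{H})$. Then $$d\omega_A(T) \leq \frac{\sqrt{2}}{2}\sqrt{\omega_A(T^2) + \frac{1}{2}\, \omega_A\left(T^\sharp T + TT^\sharp\right)+8\mu},$$ where $\mu=\omega_A^2(T)\left(2\,\omega_A^2(T) - c_A^2(T) + 2\,\omega_A(T)\sqrt{\omega_A^2(T) - c_A^2(T)}\right)$.
   Context: $\mathcal{H}$ is a complex Hilbert space with inner product $\langle\cdot\mid\cdot\rangle$, $\mathcal{B}(\mathcal{H})$ is the algebra of bounded linear operators on $\mathcal{H}$, and $A\in\mathcal{B}(\mathcal{H})$ is a fixed nonzero positive (semidefinite) operator. Put $\langle x\mid y\rangle_A=\langle Ax\mid y\rangle$ and $\|x\|_A=\langle x\mid x\rangle_A^{1/2}$. $\mathcal{B}_A(\mathcal{H})=\{T\in\mathcal{B}(\mathcal{H}) : \mathcal{R}(T^*A)\subseteq\mathcal{R}(A)\}$, where $\mathcal{R}$ denotes range; for $T\in\mathcal{B}_A(\mathcal{H})$, $T^\sharp$ denotes the unique $X\in\mathcal{B}(\mathcal{H})$ with $AX=T^*A$ and $\mathcal{R}(X)\subseteq\overline{\mathcal{R}(A)}$ (so $\langle Tx\mid y\rangle_A=\langle x\mid T^\sharp y\rangle_A$). For $T\in\mathcal{B}_A(\mathcal{H})$: $\omega_A(T)=\sup\{|\langle Tx\mid x\rangle_A| : \|x\|_A=1\}$, the $A$-Crawford number is $c_A(T)=\inf\{|\langle Tx\mid x\rangle_A| : \|x\|_A=1\}$, and the $A$-Davis-Wielandt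 radius is $d\omega_A(T)=\sup\{\sqrt{|\langle Tx\mid x\rangle_A|^2+\|Tx\|_A^4} : \|x\|_A=1\}$. All of these are finite. *)

theory Defs
  imports "HOL-Analysis.Analysis"
begin

text \<open>Complex Hilbert spaces. The norm, the metric and completeness come from \<^class>\<open>banach\<close>;
  the last axiom says that the norm is the one induced by the inner product, and in particular
  that the inner product is positive definite. The inner product is linear in its first argument.\<close>

class chilbert_space = banach +
  fixes scaleC :: "complex \<Rightarrow> 'a \<Rightarrow> 'a" (infixr "*\<^sub>C" 75)
    and cinner :: "'a \<Rightarrow> 'a \<Rightarrow> complex"
  assumes scaleC_add_right: "a *\<^sub>C (x + y) = a *\<^sub>C x + a *\<^sub>C y"
    and scaleC_add_left: "(a + b) *\<^sub>C x = a *\<^sub>C x + b *\<^sub>C x"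
    and scaleC_scaleC: "a *\<^sub>C (b *\<^sub>C x) = (a * b) *\<^sub>C x"
    and scaleR_scaleC: "scaleR r x = complex_of_real r *\<^sub>C x"
    and cinner_commute: "cinner x y = cnj (cinner y x)"
    and cinner_add_left: "cinner (x + y) z = cinner x z + cinner y z"
    and cinner_scaleC_left: "cinner (a *\<^sub>C x) y = a * cinner x y"
    and cinner_self_eq_norm: "cinner x x = complex_of_real ((norm x)\<^sup>2)"

instantiation complex :: chilbert_space
begin

definition scaleC_complex :: "complex \<Rightarrow> complex \<Rightarrow> complex"
  where "scaleC_complex a x = a * x"

definition cinner_complex :: "complex \<Rightarrow> complex \<Rightarrow> complex"
  where "cinner_complex x y = x * cnj y"

instance
  by standard
    (simp_all only: scaleC_complex_def cinner_complex_def complex_norm_square complex_cnj_mult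
      complex_cnj_cnj scaleR_conv_of_real algebra_simps)

end

definition bounded_clinear :: "('a::chilbert_space \<Rightarrow> 'a) \<Rightarrow> bool"
  where "bounded_clinear T \<longleftrightarrow> bounded_linear T \<and> (\<forall>c x. T (c *\<^sub>C x) = c *\<^sub>C T x)"

text \<open>The description is meaningful for every bounded operator, by the Riesz representation
  theorem.\<close>

definition adjoint_op :: "('a::chilbert_space \<Rightarrow> 'a) \<Rightarrow> 'a \<Rightarrow> 'a"
  where "adjoint_op T = (THE S. bounded_clinear S \<and> (\<forall>x y. cinner (T x) y = cinner x (S y)))"

definition positive_op :: "('a::chilbert_space \<Rightarrow> 'a) \<Rightarrow> bool"
  where "positive_op A \<longleftrightarrow> bounded_clinear A \<and> (\<forall>x. cinner (A x) x \<in> \<real>\<^sub>\<ge>\<^sub>0)"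

definition A_inner :: "('a::chilbert_space \<Rightarrow> 'a) \<Rightarrow> 'a \<Rightarrow> 'a \<Rightarrow> complex"
  where "A_inner A x y = cinner (A x) y"

definition A_norm :: "('a::chilbert_space \<Rightarrow> 'a) \<Rightarrow> 'a \<Rightarrow> real"
  where "A_norm A x = sqrt (Re (A_inner A x x))"

definition B_A :: "('a::chilbert_space \<Rightarrow> 'a) \<Rightarrow> ('a \<Rightarrow> 'a) set"
  where "B_A A = {T. bounded_clinear T \<and> range (adjoint_op T \<circ> A) \<subseteq> range A}"

text \<open>For \<open>T \<in> B_A A\<close> with \<open>A\<close> positive, such an operator exists by Douglas' theorem; it is
  unique because the kernel of \<open>A\<close> is orthogonal to its range.\<close>

definition A_sharp :: "('a::chilbert_space \<Rightarrow> 'a) \<Rightarrow> ('a \<Rightarrow> 'a) \<Rightarrow> 'a \<Rightarrow> 'a"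
  where "A_sharp A T =
    (THE X. bounded_clinear X \<and> A \<circ> X = adjoint_op T \<circ> A \<and> range X \<subseteq> closure (range A))"

definition A_numerical_radius :: "('a::chilbert_space \<Rightarrow> 'a) \<Rightarrow> ('a \<Rightarrow> 'a) \<Rightarrow> real"
  where "A_numerical_radius A T = (SUP x\<in>{x. A_norm A x = 1}. cmod (A_inner A (T x) x))"

definition A_Crawford_number :: "('a::chilbert_space \<Rightarrow> 'a) \<Rightarrow> ('a \<Rightarrow> 'a) \<Rightarrow> real"
  where "A_Crawford_number A T = (INF x\<in>{x. A_norm A x = 1}. cmod (A_inner A (T x) x))"

definition A_Davis_Wielandt_radius :: "('a::chilbert_space \<Rightarrow> 'a) \<Rightarrow> ('a \<Rightarrow> 'a) \<Rightarrow> real"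
  where "A_Davis_Wielandt_radius A T =
    (SUP x\<in>{x. A_norm A x = 1}. sqrt ((cmod (A_inner A (T x) x))\<^sup>2 + A_norm A (T x) ^ 4))"

end

theory Submission
  imports Defs
begin

text \<open>For \<open>\<parallel>x\<parallel>\<^sub>A = 1\<close> both summands of the Davis-Wielandt radius are bounded separately.
  Buzano's inequality for \<open>T x\<close>, \<open>T\<^sup>\<sharp> x\<close> and \<open>x\<close> gives
  \<open>\<bar>\<langle>T x, x\<rangle>\<^sub>A\<bar>\<^sup>2 \<le> \<omega>(T\<^sup>2) / 2 + \<omega>(T\<^sup>\<sharp> T + T T\<^sup>\<sharp>) / 4\<close>. The \<open>A\<close>-numerical range is convex and lies in the
  annulus \<open>c \<le> \<bar>z\<bar> \<le> \<omega>\<close>, so after a rotation of \<open>T\<close> its real part lies in \<open>[c, \<omega>]\<close> and its imaginary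
  part has modulus at most \<open>s = sqrt (\<omega>\<^sup>2 - c\<^sup>2)\<close>; hence \<open>\<parallel>T x\<parallel>\<^sub>A \<le> \<omega> + s\<close>. Since
  \<open>s \<le> \<omega>\<close> and \<open>\<mu> = \<omega>\<^sup>2 (\<omega> + s)\<^sup>2\<close>, this gives \<open>\<parallel>T x\<parallel>\<^sub>A ^ 4 \<le> 4 \<mu>\<close>.\<close>

section \<open>Positive sesquilinear forms\<close>

locale sesquilinear_form =
  fixes q :: "'a::chilbert_space \<Rightarrow> 'a \<Rightarrow> complex"
  assumes add_left: "q (x + y) z = q x z + q y z"
    and add_right: "q x (y + z) = q x y + q x z"
    and scaleC_left: "q (a *\<^sub>C x) y = a * q x y"
    and scaleC_right: "q x (a *\<^sub>C y) = cnj a * q x y"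
begin

lemma zero_left [simp]: "q 0 y = 0"
  using add_left[of 0 0 y] by simp

lemma zero_right [simp]: "q x 0 = 0"
  using add_right[of x 0 0] by simp

lemma minus_left: "q (- x) y = - q x y"
  using add_left[of x "- x" y] by (simp add: eq_neg_iff_add_eq_0 add.commute)

lemma minus_right: "q x (- y) = - q x y"
  using add_right[of x y "- y"] by (simp add: eq_neg_iff_add_eq_0 add.commute)

lemma diff_left: "q (x - y) z = q x z - q y z"
  using add_left[of x "- y" z] by (simp add: minus_left)

lemma diff_right: "q x (y - z) = q x y - q x z"
  using add_right[of x y "- z"] by (simp add: minus_right)

lemma scaleR_left: "q (r *\<^sub>R x) y = of_real r * q x y"
  by (simp add: scaleR_scaleC scaleC_left)

lemma scaleR_right: "q x (r *\<^sub>R y) = of_real r * q x y"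
  by (simp add: scaleR_scaleC scaleC_right)

lemmas expand = add_left add_right diff_left diff_right minus_left minus_right
  scaleC_left scaleC_right scaleR_left scaleR_right

text \<open>Polarization: realness at \<open>x + y\<close> makes the imaginary parts of
  \<open>q x y\<close> and \<open>q y x\<close> cancel, and realness at
  \<open>x + \<i> *\<^sub>C y\<close> equates their real parts.\<close>

lemma hermitian_if_real:
  assumes "\<And>x. q x x \<in> \<real>"
  shows "q x y = cnj (q y x)"
proof -
  have im: "Im (q x x) = 0" for x
    using assms[of x] by (simp add: complex_is_Real_iff)
  have "Im (q x y) + Im (q y x) = 0"
    using im[of "x + y"] by (simp add: expand im)
  moreover have "Re (q y x) - Re (q x y) = 0"
    using im[of "x + \<i> *\<^sub>C y"] by (simp add: expand im)
  ultimately show ?thesis by (simp add: complex_eq_iff)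
qed

end

locale positive_form = sesquilinear_form p for p :: "'a::chilbert_space \<Rightarrow> 'a \<Rightarrow> complex" +
  assumes nonneg: "p x x \<in> \<real>\<^sub>\<ge>\<^sub>0"
begin

lemma hermitian: "p x y = cnj (p y x)"
  using nonneg nonneg_Reals_subset_Reals by (intro hermitian_if_real) blast

definition seminorm :: "'a \<Rightarrow> real"
  where "seminorm x = sqrt (Re (p x x))"

lemma Re_nonneg: "0 \<le> Re (p x x)"
  using nonneg[of x] by (simp add: complex_nonneg_Reals_iff)

lemma diag: "p x x = of_real ((seminorm x)\<^sup>2)"
  using nonneg[of x] by (simp add: complex_nonneg_Reals_iff complex_eq_iff seminorm_def)

lemma seminorm_nonneg [simp]: "0 \<le> seminorm x"
  by (simp add: seminorm_def Re_nonneg)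

lemma seminorm_power2: "(seminorm x)\<^sup>2 = Re (p x x)"
  by (simp add: seminorm_def Re_nonneg)

lemma seminorm_scaleC: "seminorm (a *\<^sub>C x) = cmod a * seminorm x"
proof -
  have "(seminorm (a *\<^sub>C x))\<^sup>2 = (cmod a * seminorm x)\<^sup>2"
    unfolding power_mult_distrib seminorm_power2
    by (simp add: expand cmod_power2) (simp add: power2_eq_square algebra_simps)
  then show ?thesis
    by (simp add: power2_eq_iff_nonneg)
qed

lemma seminorm_scaleR: "seminorm (r *\<^sub>R x) = \<bar>r\<bar> * seminorm x"
  by (simp add: scaleR_scaleC seminorm_scaleC)

text \<open>Polarization and the parallelogram law bound the form by the arithmetic mean of the squared
  seminorms; rescaling the two vectors against each other turns this into the geometric mean.\<close>

lemma hermitian_form_bound: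
  assumes q: "sesquilinear_form q"
    and herm: "\<And>x y. q x y = cnj (q y x)"
    and bound: "\<And>x. cmod (q x x) \<le> K * (seminorm x)\<^sup>2" and "0 \<le> K"
  shows "cmod (q x y) \<le> K * seminorm x * seminorm y"
proof -
  interpret q: sesquilinear_form q by (rule q)
  have re: "Re (q x y) \<le> K * ((seminorm x)\<^sup>2 + (seminorm y)\<^sup>2) / 2" for x y
  proof -
    have "4 * Re (q x y) = Re (q (x + y) (x + y)) - Re (q (x - y) (x - y))"
      using herm[of y x] by (simp add: q.expand)
    also have "\<dots> \<le> K * (seminorm (x + y))\<^sup>2 + K * (seminorm (x - y))\<^sup>2"
      using bound[of "x + y"] bound[of "x - y"] abs_Re_le_cmod[of "q (x + y) (x + y)"]
        abs_Re_le_cmod[of "q (x - y) (x - y)"] by linarith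
    also have "\<dots> = 2 * K * ((seminorm x)\<^sup>2 + (seminorm y)\<^sup>2)"
      by (simp add: seminorm_power2 expand algebra_simps)
    finally show ?thesis by simp
  qed
  have mean: "cmod (q x y) \<le> K * ((seminorm x)\<^sup>2 + (seminorm y)\<^sup>2) / 2" for x y
  proof (cases "q x y = 0")
    case False
    \<comment> \<open>Rotating \<open>x\<close> by the conjugate phase turns \<open>q x y\<close>
      into its modulus, so the bound on real parts becomes a bound on the modulus.\<close>
    define u where "u = cnj (q x y) / cmod (q x y)"
    have "cmod u = 1" using False by (simp add: u_def norm_divide)
    moreover have "q (u *\<^sub>C x) y = cmod (q x y)"
      using False by (simp add: q.expand u_def complex_norm_square[symmetric] power2_eq_square mult.commute)
    ultimately show ?thesis
      using re[of "u *\<^sub>C x" y] by (simp add: seminorm_scaleC)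
  qed (use \<open>0 \<le> K\<close> in simp)
  have scaled: "cmod (q x y) \<le> K * (t\<^sup>2 * (seminorm x)\<^sup>2 + (seminorm y)\<^sup>2 / t\<^sup>2) / 2" if "t > 0" for t x y
    using mean[of "t *\<^sub>R x" "(1 / t) *\<^sub>R y"] that
    by (simp add: q.expand seminorm_scaleR norm_mult power_mult_distrib power_divide norm_divide)
  have zero: "q x y = 0" if "seminorm x = 0" for x y
  proof (rule ccontr)
    assume "q x y \<noteq> 0"
    then have pos: "cmod (q x y) > 0" by simp
    \<comment> \<open>For a null vector \<open>x\<close>, \<open>scaled\<close> bounds
      \<open>2 * t^2 * cmod (q x y)\<close> by a quantity free of \<open>t\<close>. This
      \<open>t\<close> is large enough to violate that; the summand 1 keeps it positive.\<close>
    define t where "t = sqrt (K * (seminorm y)\<^sup>2 / cmod (q x y) + 1)"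
    have arg: "0 < K * (seminorm y)\<^sup>2 / cmod (q x y) + 1"
      using pos \<open>0 \<le> K\<close> by (simp add: add_nonneg_pos)
    then have t: "t > 0" "t\<^sup>2 = K * (seminorm y)\<^sup>2 / cmod (q x y) + 1"
      by (simp_all add: t_def)
    have "cmod (q x y) * (2 * t\<^sup>2) \<le> K * (seminorm y)\<^sup>2"
      using scaled[OF t(1), of x y] that t(1) by (simp add: field_simps)
    also have "cmod (q x y) * (2 * t\<^sup>2) = 2 * K * (seminorm y)\<^sup>2 + 2 * cmod (q x y)"
      unfolding t(2) using pos by (simp add: field_simps)
    finally have "K * (seminorm y)\<^sup>2 + 2 * cmod (q x y) \<le> 0" by simp
    moreover have "0 \<le> K * (seminorm y)\<^sup>2" using \<open>0 \<le> K\<close> by simp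
    ultimately show False using pos by linarith
  qed
  show ?thesis
  proof (cases "seminorm x = 0 \<or> seminorm y = 0")
    case True
    then have "q x y = 0" using zero[of x y] zero[of y x] herm[of x y] by auto
    then show ?thesis using \<open>0 \<le> K\<close> by simp
  next
    case False
    then have x: "seminorm x > 0" and y: "seminorm y > 0"
      using seminorm_nonneg[of x] seminorm_nonneg[of y] by linarith+
    \<comment> \<open>This \<open>t\<close> balances the two summands of \<open>scaled\<close>: both
      become \<open>seminorm x * seminorm y\<close>.\<close>
    define t where "t = sqrt (seminorm y / seminorm x)"
    have "t > 0" "t\<^sup>2 = seminorm y / seminorm x" using x y by (simp_all add: t_def)
    moreover have "seminorm y / seminorm x * (seminorm x)\<^sup>2 = seminorm x * seminorm y"
      "(seminorm y)\<^sup>2 / (seminorm y / seminorm x) = seminorm x * seminorm y"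
      using x y by (simp_all add: power2_eq_square)
    ultimately show ?thesis
      using scaled[of t x y] by simp
  qed
qed

lemma Cauchy_Schwarz: "cmod (p x y) \<le> seminorm x * seminorm y"
  using hermitian_form_bound[OF sesquilinear_form_axioms hermitian, of 1 x y]
  by (simp add: diag norm_power)

lemma Cauchy_Schwarz_zero: "seminorm x = 0 \<Longrightarrow> p x y = 0" "seminorm x = 0 \<Longrightarrow> p y x = 0"
  using Cauchy_Schwarz[of x y] Cauchy_Schwarz[of y x] by auto

lemma ex_unit:
  assumes "p x y \<noteq> 0"
  shows "\<exists>z. seminorm z = 1"
proof -
  have x: "seminorm x \<noteq> 0" using assms Cauchy_Schwarz_zero by blast
  then have "seminorm ((1 / seminorm x) *\<^sub>R x) = 1"
    by (simp add: seminorm_scaleR)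
  then show ?thesis ..
qed

text \<open>Transfers bounds from unit vectors to all vectors by scaling. Null vectors of the
  seminorm cannot be normalized, hence the separate condition on them.\<close>

lemma homogeneous_le:
  fixes \<phi> :: "'a \<Rightarrow> real"
  assumes scale: "\<And>r x. \<phi> (r *\<^sub>R x) = r\<^sup>2 * \<phi> x"
    and bound: "\<And>x. seminorm x = 1 \<Longrightarrow> \<phi> x \<le> K"
    and zero: "\<And>x. seminorm x = 0 \<Longrightarrow> \<phi> x \<le> 0"
  shows "\<phi> x \<le> K * (seminorm x)\<^sup>2"
proof (cases "seminorm x = 0")
  case False
  have "\<phi> ((1 / seminorm x) *\<^sub>R x) \<le> K"
    using False by (intro bound) (simp add: seminorm_scaleR)
  then have "\<phi> x / (seminorm x)\<^sup>2 \<le> K"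
    by (simp add: scale power_divide)
  then show ?thesis
    using False by (simp add: pos_divide_le_eq)
qed (use zero in simp)

text \<open>The vector \<open>z\<close> is the reflection of \<open>x\<close> in the line spanned by
  \<open>e\<close>, so it has the same seminorm; Cauchy-Schwarz for \<open>z\<close> and
  \<open>y\<close> and the triangle inequality finish.\<close>

lemma Buzano:
  assumes "seminorm e = 1"
  shows "cmod (p x e * p e y) \<le> (cmod (p x y) + seminorm x * seminorm y) / 2"
proof -
  define z where "z = (2 * p x e) *\<^sub>C e - x"
  have e: "p e e = 1" by (simp add: diag assms)
  have "(seminorm z)\<^sup>2 = (seminorm x)\<^sup>2"
    unfolding seminorm_power2 z_def using hermitian[of e x]
    by (simp add: expand e algebra_simps)
  then have "seminorm z = seminorm x" by (simp add: power2_eq_iff_nonneg)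
  moreover have "p z y = 2 * (p x e * p e y) - p x y" by (simp add: z_def expand)
  ultimately have "cmod (2 * (p x e * p e y) - p x y) \<le> seminorm x * seminorm y"
    using Cauchy_Schwarz[of z y] by simp
  then show ?thesis
    using norm_triangle_ineq[of "2 * (p x e * p e y) - p x y" "p x y"] by (simp add: norm_mult)
qed

subsection \<open>The numerical range\<close>

definition num_range :: "('a \<Rightarrow> 'a \<Rightarrow> complex) \<Rightarrow> complex set"
  where "num_range q = (\<lambda>x. q x x) ` {x. seminorm x = 1}"

text \<open>The form is \<open>h + \<i> k\<close> up to a unimodular factor, with \<open>h\<close> and \<open>k\<close> Hermitian.\<close>

lemma Cartesian_decomposition_bound:
  assumes q: "sesquilinear_form q" and u: "cmod u = 1"
    and re: "\<And>x. \<bar>Re (u * q x x)\<bar> \<le> a * (seminorm x)\<^sup>2" and "0 \<le> a"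
    and im: "\<And>x. \<bar>Im (u * q x x)\<bar> \<le> b * (seminorm x)\<^sup>2" and "0 \<le> b"
  shows "cmod (q x y) \<le> (a + b) * seminorm x * seminorm y"
proof -
  interpret q: sesquilinear_form q by (rule q)
  define h where "h x y = (u * q x y + cnj (u * q y x)) / 2" for x y
  define k where "k x y = (u * q x y - cnj (u * q y x)) / (2 * \<i>)" for x y
  have h: "sesquilinear_form h" and k: "sesquilinear_form k"
    by (unfold_locales; simp add: h_def k_def q.expand field_simps)+
  have "cmod (h x y) \<le> a * seminorm x * seminorm y"
  proof (rule hermitian_form_bound[OF h _ _ \<open>0 \<le> a\<close>])
    show "h x y = cnj (h y x)" for x y by (simp add: h_def add.commute)
    have "h x x = of_real (Re (u * q x x))" for x
      by (simp add: h_def complex_eq_iff)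
    then show "cmod (h x x) \<le> a * (seminorm x)\<^sup>2" for x
      using re[of x] by (simp del: of_real_diff)
  qed
  moreover have "cmod (k x y) \<le> b * seminorm x * seminorm y"
  proof (rule hermitian_form_bound[OF k _ _ \<open>0 \<le> b\<close>])
    show "k x y = cnj (k y x)" for x y by (simp add: k_def field_simps)
    have "(z - cnj z) / (2 * \<i>) = of_real (Im z)" for z
      by (simp add: complex_eq_iff)
    then have "k x x = of_real (Im (u * q x x))" for x
      unfolding k_def .
    then show "cmod (k x x) \<le> b * (seminorm x)\<^sup>2" for x
      using im[of x] by (simp del: of_real_add)
  qed
  moreover have "u * q x y = h x y + \<i> * k x y"
    by (simp add: h_def k_def field_simps)
  then have "cmod (q x y) \<le> cmod (h x y) + cmod (k x y)"
    using norm_triangle_ineq[of "h x y" "\<i> * k x y"] u by (metis norm_mult norm_ii mult_1)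
  ultimately show ?thesis by (simp add: algebra_simps)
qed

text \<open>Real and imaginary parts are each dominated by the modulus, whence the factor 2. The
  bound also shows that null vectors of the seminorm lie in the kernel of \<open>q\<close>.\<close>

lemma numerical_radius_bound:
  assumes q: "sesquilinear_form q" and bound: "\<And>x. cmod (q x x) \<le> w * (seminorm x)\<^sup>2"
    and "0 \<le> w"
  shows "cmod (q x y) \<le> 2 * w * seminorm x * seminorm y"
proof -
  have "\<bar>Re (1 * q x x)\<bar> \<le> w * (seminorm x)\<^sup>2" "\<bar>Im (1 * q x x)\<bar> \<le> w * (seminorm x)\<^sup>2" for x
    using bound[of x] abs_Re_le_cmod[of "q x x"] abs_Im_le_cmod[of "q x x"] by simp_all
  from Cartesian_decomposition_bound[OF q norm_one this(1) \<open>0 \<le> w\<close> this(2) \<open>0 \<le> w\<close>]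
  show ?thesis by simp
qed

text \<open>An affine change of \<open>q\<close> moves the two given values to 0 and 1. A path from
  \<open>x\<close> to a rotated \<open>y\<close> keeps the new form real, and the intermediate value
  theorem hits every \<open>s\<close> between. The kernel conditions exclude null vectors on the
  path.\<close>

theorem Toeplitz_Hausdorff:
  assumes q: "sesquilinear_form q"
    and kernel: "\<And>z y. seminorm z = 0 \<Longrightarrow> q z y = 0" "\<And>z y. seminorm z = 0 \<Longrightarrow> q y z = 0"
  shows "convex (num_range q)"
proof (unfold convex_alt, intro ballI allI impI)
  fix a b :: complex and s :: real
  assume "a \<in> num_range q" "b \<in> num_range q" and s: "0 \<le> s \<and> s \<le> 1"
  then obtain x y where x: "seminorm x = 1" "a = q x x" and y: "seminorm y = 1" "b = q y y"
    by (auto simp: num_range_def)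
  interpret q: sesquilinear_form q by (rule q)
  show "(1 - s) *\<^sub>R a + s *\<^sub>R b \<in> num_range q"
  proof (cases "a = b")
    case True
    then show ?thesis
      using \<open>a \<in> num_range q\<close> by (simp flip: scaleR_left_distrib)
  next
    case False
    define r where "r v w = (q v w - a * p v w) / (b - a)" for v w
    interpret r: sesquilinear_form r
      by unfold_locales (simp_all add: r_def q.expand expand diff_divide_distrib algebra_simps add_divide_distrib)
    have rx: "r x x = 0" and ry: "r y y = 1"
      using x y False by (simp_all add: r_def diag)
    have r_kernel: "r z v = 0" "r v z = 0" if "seminorm z = 0" for z v
      using kernel[OF that] Cauchy_Schwarz_zero[OF that] by (simp_all add: r_def)
    define \<delta> where "\<delta> = r y x - cnj (r x y)"
    \<comment> \<open>The imaginary part of the cross term along the path equals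
      \<open>Im (l * \<delta>)\<close>, so \<open>l\<close> cancels the phase of
      \<open>\<delta>\<close>.\<close>
    define l where "l = (if \<delta> = 0 then 1 else cnj \<delta> / cmod \<delta>)"
    have l: "cmod l = 1" by (simp add: l_def norm_divide)
    have ll: "l * cnj l = 1" using l by (simp add: complex_norm_square[symmetric])
    have "l * \<delta> = cmod \<delta>"
      by (simp add: l_def complex_norm_square[symmetric] power2_eq_square mult.commute)
    then have "Im (l * \<delta>) = 0" by simp
    then have cross: "Im (cnj l * r x y + l * r y x) = 0"
      by (simp add: \<delta>_def algebra_simps)
    define z where "z t = (1 - t) *\<^sub>R x + t *\<^sub>R (l *\<^sub>C y)" for t :: real
    have r_z: "r (z t) (z t) = of_real (t\<^sup>2) + of_real (t * (1 - t)) * (cnj l * r x y + l * r y x)" for t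
    proof -
      have "r (z t) (z t) = of_real (t\<^sup>2) * (l * cnj l)
          + of_real (t * (1 - t)) * (cnj l * r x y + l * r y x)"
        by (simp add: z_def r.expand rx ry power2_eq_square) (simp add: algebra_simps)
      then show ?thesis by (simp add: ll)
    qed
    \<comment> \<open>Pairing a null \<open>z t\<close> with \<open>x\<close> and with
      \<open>y\<close> under \<open>r\<close> forces \<open>t = 0\<close>, but
      \<open>z 0 = x\<close> is a unit vector.\<close>
    have nz: "seminorm (z t) \<noteq> 0" for t
    proof
      assume 0: "seminorm (z t) = 0"
      have "t * (l * r y x) = 0" "(1 - t) * r y x + t * cnj l = 0"
        using r_kernel[OF 0, of x] r_kernel[OF 0, of y] by (simp_all add: z_def r.expand rx ry)
      then have "t = 0" using l by auto
      then show False using 0 x(1) by (simp add: z_def)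
    qed
    define g where "g t = Re (r (z t) (z t)) / (seminorm (z t))\<^sup>2" for t
    have "continuous_on {0..1} g"
      unfolding g_def
    proof (intro continuous_on_divide)
      show "continuous_on {0..1} (\<lambda>t. Re (r (z t) (z t)))"
        unfolding r_z by (intro continuous_intros)
      show "continuous_on {0..1} (\<lambda>t. (seminorm (z t))\<^sup>2)"
        unfolding seminorm_power2 by (simp add: z_def expand) (intro continuous_intros)
    qed (use nz in auto)
    moreover have "g 0 = 0" "g 1 = 1"
      using ll l y by (simp_all add: g_def r_z) (simp add: z_def seminorm_scaleC)
    ultimately obtain t where t: "g t = s"
      using IVT'[of g 0 s 1] s by auto
    define v where "v = (1 / seminorm (z t)) *\<^sub>R z t"
    have v: "seminorm v = 1" using nz[of t] by (simp add: v_def seminorm_scaleR)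
    have "Im (r (z t) (z t)) = 0" using cross unfolding r_z by simp
    then have "r (z t) (z t) = of_real (Re (r (z t) (z t)))"
      by (simp add: complex_eq_iff)
    then have "r v v = of_real s"
      using nz[of t] t[symmetric] by (simp add: v_def r.expand g_def power2_eq_square)
    then have "q v v = (1 - s) *\<^sub>R a + s *\<^sub>R b"
      using False v by (simp add: r_def diag field_simps scaleR_conv_of_real)
    then show ?thesis
      using v by (force simp: num_range_def)
  qed
qed

text \<open>The point \<open>z\<close> of the closed convex hull of values nearest to 0 is nonzero
  because \<open>0 < c\<close>. The line through \<open>z\<close> perpendicular to it supports the
  set, and \<open>u\<close> turns \<open>z\<close> onto the positive real axis.\<close>

lemma ex_supporting_rotation:
  assumes "convex (num_range q)" "num_range q \<noteq> {}" "0 < c"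
    and lower: "\<And>x. seminorm x = 1 \<Longrightarrow> c \<le> cmod (q x x)"
  obtains u where "cmod u = 1" "\<And>x. seminorm x = 1 \<Longrightarrow> c \<le> Re (u * q x x)"
proof -
  define S where "S = closure (num_range q)"
  have S: "convex S" "closed S" "S \<noteq> {}"
    using assms by (auto simp: S_def convex_closure)
  define z where "z = closest_point S 0"
  have "z \<in> S" using S by (simp add: z_def closest_point_in_set)
  have "num_range q \<subseteq> {w. c \<le> cmod w}" using lower by (auto simp: num_range_def)
  then have "S \<subseteq> {w. c \<le> cmod w}"
    unfolding S_def by (rule closure_minimal) (intro closed_Collect_le continuous_intros)
  then have z: "c \<le> cmod z" using \<open>z \<in> S\<close> by auto
  then have z0: "cmod z > 0" using \<open>0 < c\<close> by linarith
  define u where "u = cnj z / cmod z"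
  show thesis
  proof
    show "cmod u = 1" using z0 by (simp add: u_def norm_divide)
    fix x assume "seminorm x = 1"
    then have "q x x \<in> num_range q" by (simp add: num_range_def)
    then have "q x x \<in> S" using closure_subset unfolding S_def by blast
    then have "inner (0 - z) (q x x - z) \<le> 0"
      unfolding z_def by (intro closest_point_dot S)
    then have "(cmod z)\<^sup>2 \<le> inner z (q x x)"
      by (simp add: inner_diff_right power2_norm_eq_inner)
    also have "inner z (q x x) = Re (cnj z * q x x)" by (simp add: inner_complex_def)
    finally have "cmod z \<le> Re (cnj z * q x x) / cmod z"
      using z0 by (simp add: pos_le_divide_eq power2_eq_square)
    also have "\<dots> = Re (u * q x x)" by (simp add: u_def)
    finally show "c \<le> Re (u * q x x)" using z by linarith
  qed
qed

text \<open>The numerical range is a convex subset of the annulus \<open>c \<le> \<bar>z\<bar> \<le> w\<close>, so after a rotation it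
  lies in the half-plane \<open>Re z \<ge> c\<close>, where \<open>\<bar>Im z\<bar> \<le> sqrt (w\<^sup>2 - c\<^sup>2)\<close>.\<close>

theorem annulus_bound:
  assumes q: "sesquilinear_form q" and bound: "\<And>x. cmod (q x x) \<le> w * (seminorm x)\<^sup>2" and "0 \<le> w"
    and lower: "\<And>x. seminorm x = 1 \<Longrightarrow> c \<le> cmod (q x x)" and "0 \<le> c"
    and unit: "\<exists>x. seminorm x = 1"
  shows "cmod (q x y) \<le> (w + sqrt (w\<^sup>2 - c\<^sup>2)) * seminorm x * seminorm y"
\<comment> \<open>For \<open>c = 0\<close> the annulus is a full disc and no rotation is available,
  but then the claim is just the factor \<open>2 * w\<close>.\<close>
proof (cases "c = 0")
  case True
  then show ?thesis
    using numerical_radius_bound[OF q bound \<open>0 \<le> w\<close>, of x y] \<open>0 \<le> w\<close> by simp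
next
  case False
  interpret q: sesquilinear_form q by (rule q)
  have kernel: "q z y = 0" "q y z = 0" if "seminorm z = 0" for z y
    using numerical_radius_bound[OF q bound \<open>0 \<le> w\<close>, of z y]
      numerical_radius_bound[OF q bound \<open>0 \<le> w\<close>, of y z] that by simp_all
  have "num_range q \<noteq> {}" using unit by (auto simp: num_range_def)
  then obtain u where u: "cmod u = 1" and Re_u: "\<And>x. seminorm x = 1 \<Longrightarrow> c \<le> Re (u * q x x)"
    using ex_supporting_rotation[OF Toeplitz_Hausdorff[OF q kernel] _ _ lower] False \<open>0 \<le> c\<close>
    by (metis less_eq_real_def)
  have mod: "cmod (u * q x x) \<le> w * (seminorm x)\<^sup>2" for x
    using bound[of x] u by (simp add: norm_mult)
  have re: "\<bar>Re (u * q x x)\<bar> \<le> w * (seminorm x)\<^sup>2" for x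
    using mod[of x] abs_Re_le_cmod[of "u * q x x"] by linarith
  have im: "\<bar>Im (u * q x x)\<bar> \<le> sqrt (w\<^sup>2 - c\<^sup>2)" if "seminorm x = 1" for x
  proof (rule real_le_rsqrt)
    have "c\<^sup>2 \<le> (Re (u * q x x))\<^sup>2" using Re_u[OF that] \<open>0 \<le> c\<close> by (intro power_mono)
    moreover have "(cmod (u * q x x))\<^sup>2 \<le> w\<^sup>2" using mod[of x] that by (intro power_mono) simp_all
    ultimately show "\<bar>Im (u * q x x)\<bar>\<^sup>2 \<le> w\<^sup>2 - c\<^sup>2" by (simp add: cmod_power2)
  qed
  have "\<bar>Im (u * q x x)\<bar> \<le> sqrt (w\<^sup>2 - c\<^sup>2) * (seminorm x)\<^sup>2" for x
  proof (rule homogeneous_le[OF _ im])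
    have "u * q (r *\<^sub>R x) (r *\<^sub>R x) = of_real (r\<^sup>2) * (u * q x x)" for r x
      by (simp add: q.expand power2_eq_square)
    moreover have "Im (of_real t * z) = t * Im z" for t z by simp
    ultimately show "\<bar>Im (u * q (r *\<^sub>R x) (r *\<^sub>R x))\<bar> = r\<^sup>2 * \<bar>Im (u * q x x)\<bar>" for r x
      by (metis abs_mult abs_power2)
  qed (simp_all add: kernel)
  \<comment> \<open>\<open>sqrt\<close> is negative at negative arguments, so its sign is read off
    from \<open>im\<close> at a unit vector.\<close>
  moreover have "0 \<le> sqrt (w\<^sup>2 - c\<^sup>2)" using unit im abs_ge_zero order_trans by blast
  ultimately show ?thesis
    using Cartesian_decomposition_bound[OF q u re \<open>0 \<le> w\<close>] by blast
qed

end

section \<open>Complex Hilbert spaces\<close>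

lemma cinner_positive_form: "positive_form (cinner :: 'a::chilbert_space \<Rightarrow> 'a \<Rightarrow> complex)"
proof
  fix x y z :: 'a and a
  show add: "cinner (x + y) z = cinner x z + cinner y z"
    and scale: "cinner (a *\<^sub>C x) y = a * cinner x y" for x y z :: 'a and a
    by (simp_all add: cinner_add_left cinner_scaleC_left)
  show "cinner x (y + z) = cinner x y + cinner x z"
    using cinner_commute[of x] add by (metis complex_cnj_add)
  show "cinner x (a *\<^sub>C y) = cnj a * cinner x y"
    using cinner_commute[of x] scale by (metis complex_cnj_mult)
  show "cinner x x \<in> \<real>\<^sub>\<ge>\<^sub>0"
    by (simp add: cinner_self_eq_norm)
qed

interpretation cinner: positive_form "cinner :: 'a::chilbert_space \<Rightarrow> 'a \<Rightarrow> complex"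
  rewrites "positive_form.seminorm cinner = (norm :: 'a \<Rightarrow> real)"
proof -
  interpret positive_form "cinner :: 'a \<Rightarrow> 'a \<Rightarrow> complex"
    by (rule cinner_positive_form)
  show "positive_form (cinner :: 'a \<Rightarrow> 'a \<Rightarrow> complex)"
    by (rule cinner_positive_form)
  show "seminorm = (norm :: 'a \<Rightarrow> real)"
    by (simp add: seminorm_def cinner_self_eq_norm fun_eq_iff)
qed

lemma norm_scaleC: "norm (a *\<^sub>C x) = cmod a * norm (x::'a::chilbert_space)"
  by (rule cinner.seminorm_scaleC)

lemma bounded_linear_cinner_left: "bounded_linear (\<lambda>x. cinner x (y::'a::chilbert_space))"
  by (rule bounded_linear_intro[of _ "norm y"])
    (simp_all add: cinner.expand cinner.Cauchy_Schwarz scaleR_conv_of_real)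

lemma bounded_linear_cinner_right: "bounded_linear (\<lambda>y. cinner (x::'a::chilbert_space) y)"
  by (rule bounded_linear_intro[of _ "norm x"])
    (simp_all add: cinner.expand cinner.Cauchy_Schwarz scaleR_conv_of_real mult.commute[of _ "norm x"])

lemma cinner_eqI:
  assumes "\<And>z. cinner (x::'a::chilbert_space) z = cinner y z"
  shows "x = y"
proof -
  have "cinner (x - y) (x - y) = 0"
    by (simp only: cinner.diff_left assms) simp
  then show ?thesis by (simp add: cinner_self_eq_norm)
qed

lemma cinner_eqI':
  assumes "\<And>z. cinner z (x::'a::chilbert_space) = cinner z y"
  shows "x = y"
  using cinner_eqI assms cinner.hermitian by metis

section \<open>Complex subspaces and orthogonal projection\<close>

definition csubspace :: "'a::chilbert_space set \<Rightarrow> bool"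
  where "csubspace M \<longleftrightarrow> 0 \<in> M \<and> (\<forall>x\<in>M. \<forall>y\<in>M. x + y \<in> M) \<and> (\<forall>c. \<forall>x\<in>M. c *\<^sub>C x \<in> M)"

lemma csubspace_diff:
  assumes "csubspace M" "x \<in> M" "y \<in> M"
  shows "x - y \<in> M"
proof -
  have "- y = (-1) *\<^sub>C y"
    using scaleR_scaleC[of "-1" y] by simp
  then have "- y \<in> M" using assms unfolding csubspace_def by metis
  then have "x + (- y) \<in> M" using assms unfolding csubspace_def by blast
  then show ?thesis by simp
qed

lemma csubspace_closure:
  assumes "csubspace (M :: 'a::chilbert_space set)"
  shows "csubspace (closure M)"
  unfolding csubspace_def
proof (intro conjI ballI allI)
  show "0 \<in> closure M"
    using assms closure_subset by (auto simp: csubspace_def)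
  fix x assume "x \<in> closure M"
  then obtain f where f: "\<And>n. f n \<in> M" "f \<longlonglongrightarrow> x"
    by (auto simp: closure_sequential)
  {
    fix y assume "y \<in> closure M"
    then obtain g where "\<And>n. g n \<in> M" "g \<longlonglongrightarrow> y"
      by (auto simp: closure_sequential)
    with f assms have "\<And>n. f n + g n \<in> M" "(\<lambda>n. f n + g n) \<longlonglongrightarrow> x + y"
      by (auto simp: csubspace_def intro: tendsto_add)
    then show "x + y \<in> closure M"
      unfolding closure_sequential by (intro exI[of _ "\<lambda>n. f n + g n"]) blast
  next
    fix c
    have "bounded_linear (\<lambda>x :: 'a. c *\<^sub>C x)"
      by (rule bounded_linear_intro[of _ "cmod c"])
        (simp_all add: scaleC_add_right scaleR_scaleC scaleC_scaleC norm_scaleC mult.commute)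
    then have "(\<lambda>n. c *\<^sub>C f n) \<longlonglongrightarrow> c *\<^sub>C x"
      using f(2) bounded_linear.tendsto by blast
    moreover have "\<And>n. c *\<^sub>C f n \<in> M"
      using f assms by (simp add: csubspace_def)
    ultimately show "c *\<^sub>C x \<in> closure M"
      unfolding closure_sequential by (intro exI[of _ "\<lambda>n. c *\<^sub>C f n"]) blast
  }
qed

lemma parallelogram:
  "(norm (x + y))\<^sup>2 + (norm (x - y))\<^sup>2 = 2 * (norm (x::'a::chilbert_space))\<^sup>2 + 2 * (norm y)\<^sup>2"
  unfolding cinner.seminorm_power2 by (simp add: cinner.expand)

text \<open>Midpoints of a minimizing sequence stay in \<open>M\<close>, at squared distance at
  least \<open>d\<close> from \<open>x\<close>; the parallelogram law then makes the sequence
  Cauchy.\<close>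

lemma ex_nearest_point:
  fixes M :: "'a::chilbert_space set"
  assumes M: "csubspace M" "closed M"
  obtains m where "m \<in> M" "\<And>y. y \<in> M \<Longrightarrow> norm (x - m) \<le> norm (x - y)"
proof -
  define d where "d = (INF y\<in>M. (norm (x - y))\<^sup>2)"
  have "M \<noteq> {}" using M by (auto simp: csubspace_def)
  have bdd: "bdd_below ((\<lambda>y. (norm (x - y))\<^sup>2) ` M)"
    by (intro bdd_belowI[of _ 0]) auto
  have d: "d \<le> (norm (x - y))\<^sup>2" if "y \<in> M" for y
    unfolding d_def using bdd that by (rule cINF_lower)
  have "\<exists>y\<in>M. (norm (x - y))\<^sup>2 < d + 1 / Suc n" for n
    using cINF_less_iff[OF \<open>M \<noteq> {}\<close> bdd, of "d + 1 / Suc n"] by (simp add: d_def)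
  then obtain f where f: "\<And>n. f n \<in> M" "\<And>n. (norm (x - f n))\<^sup>2 < d + 1 / Suc n"
    by metis
  have dist: "(norm (f i - f j))\<^sup>2 \<le> 2 / Suc i + 2 / Suc j" for i j
  proof -
    have "(1/2) *\<^sub>R (f i + f j) \<in> M"
      using f M by (simp add: csubspace_def scaleR_scaleC)
    then have "4 * d \<le> 4 * (norm (x - (1/2) *\<^sub>R (f i + f j)))\<^sup>2"
      using d by simp
    also have "\<dots> = (norm (2 *\<^sub>R (x - (1/2) *\<^sub>R (f i + f j))))\<^sup>2"
      by (simp add: power_mult_distrib)
    also have "2 *\<^sub>R (x - (1/2) *\<^sub>R (f i + f j)) = (x - f i) + (x - f j)"
      by (simp add: algebra_simps scaleR_2)
    also have "(norm \<dots>)\<^sup>2 = 2 * (norm (x - f i))\<^sup>2 + 2 * (norm (x - f j))\<^sup>2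
        - (norm ((x - f i) - (x - f j)))\<^sup>2"
      using parallelogram[of "x - f i" "x - f j"] by simp
    finally have "4 * d \<le> 2 * (norm (x - f i))\<^sup>2 + 2 * (norm (x - f j))\<^sup>2 - (norm (f i - f j))\<^sup>2"
      by (simp add: norm_minus_commute)
    with f(2)[of i] f(2)[of j] show ?thesis by simp
  qed
  have "Cauchy f"
  proof (rule metric_CauchyI)
    fix e :: real assume "e > 0"
    then obtain N where N: "1 / Suc N < e\<^sup>2 / 4"
      using nat_approx_posE[of "e\<^sup>2 / 4"] by auto
    have "dist (f i) (f j) < e" if "i \<ge> N" "j \<ge> N" for i j
    proof -
      have "1 / Suc i \<le> 1 / Suc N" "1 / Suc j \<le> 1 / Suc N"
        using that by (simp_all add: frac_le)
      then have "(norm (f i - f j))\<^sup>2 < e\<^sup>2"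
        using dist[of i j] N by simp
      then show ?thesis
        using \<open>e > 0\<close> by (simp add: dist_norm power2_less_imp_less)
    qed
    then show "\<exists>N. \<forall>i\<ge>N. \<forall>j\<ge>N. dist (f i) (f j) < e" by blast
  qed
  then obtain m where m: "f \<longlonglongrightarrow> m" by (auto simp: Cauchy_convergent_iff convergent_def)
  have "m \<in> M" using M(2) f(1) m closed_sequentially by blast
  moreover have "(norm (x - m))\<^sup>2 \<le> d"
  proof (rule LIMSEQ_le)
    show "(\<lambda>n. (norm (x - f n))\<^sup>2) \<longlonglongrightarrow> (norm (x - m))\<^sup>2"
      by (intro tendsto_intros m)
    show "(\<lambda>n. d + 1 / Suc n) \<longlonglongrightarrow> d"
      using tendsto_add[OF tendsto_const[of d] LIMSEQ_inverse_real_of_nat] by (simp add: inverse_eq_divide)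
    show "\<exists>N. \<forall>n\<ge>N. (norm (x - f n))\<^sup>2 \<le> d + 1 / Suc n"
      using f(2) less_imp_le by blast
  qed
  ultimately show thesis
    using d that by (meson norm_ge_zero order_trans power2_le_imp_le)
qed

lemma ex_orthogonal_projection:
  fixes M :: "'a::chilbert_space set"
  assumes M: "csubspace M" "closed M"
  obtains m where "m \<in> M" "\<And>y. y \<in> M \<Longrightarrow> cinner (x - m) y = 0"
proof -
  obtain m where m: "m \<in> M" "\<And>y. y \<in> M \<Longrightarrow> norm (x - m) \<le> norm (x - y)"
    using ex_nearest_point[OF M] by blast
  show thesis
  proof (rule that[OF m(1)])
    fix y assume y: "y \<in> M"
    show "cinner (x - m) y = 0"
    proof (cases "y = 0")
      case False
      define w where "w = x - m"
      \<comment> \<open>The coefficient of the projection of \<open>w\<close> onto \<open>y\<close>: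
        subtracting it lowers the squared norm by \<open>(cmod (cinner w y))^2 / (norm y)^2\<close>,
        which minimality forces to be 0.\<close>
      define a where "a = cinner w y / of_real ((norm y)\<^sup>2)"
      have "m + a *\<^sub>C y \<in> M" using M m(1) y by (simp add: csubspace_def)
      then have "(norm w)\<^sup>2 \<le> (norm (w - a *\<^sub>C y))\<^sup>2"
        using m(2) unfolding w_def by (intro power_mono) (simp_all add: diff_diff_eq)
      moreover have "complex_of_real ((norm (w - a *\<^sub>C y))\<^sup>2) = of_real ((norm w)\<^sup>2) - of_real ((cmod (cinner w y))\<^sup>2 / (norm y)\<^sup>2)"
        using False cinner.hermitian[of y w]
        unfolding cinner_self_eq_norm[symmetric] cinner.expand
        by (simp add: cinner_self_eq_norm a_def complex_norm_square[symmetric] field_simps)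
      then have "(norm (w - a *\<^sub>C y))\<^sup>2 = (norm w)\<^sup>2 - (cmod (cinner w y))\<^sup>2 / (norm y)\<^sup>2"
        by (simp only: of_real_diff[symmetric] of_real_eq_iff)
      ultimately have "(cmod (cinner w y))\<^sup>2 / (norm y)\<^sup>2 \<le> 0" by simp
      then show ?thesis
        using False by (simp add: w_def divide_le_0_iff)
    qed simp
  qed
qed

section \<open>Adjoints\<close>

text \<open>A vector \<open>w\<close> orthogonal to the closed kernel of \<open>f\<close> represents
  \<open>f\<close> up to a factor, since \<open>x - (f x / f w) *\<^sub>C w\<close> lies in that
  kernel. The factor is fixed by the value at \<open>w\<close>.\<close>

theorem Riesz_representation:
  fixes f :: "'a::chilbert_space \<Rightarrow> complex"
  assumes "bounded_linear f" and scale: "\<And>c x. f (c *\<^sub>C x) = c * f x"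
  obtains y where "\<And>x. f x = cinner x y"
proof (cases "\<forall>x. f x = 0")
  case True
  then show ?thesis using that[of 0] by simp
next
  case False
  then obtain v where v: "f v \<noteq> 0" by blast
  interpret f: bounded_linear f by fact
  define M where "M = {x. f x = 0}"
  have "csubspace M" by (simp add: csubspace_def M_def f.add f.zero scale)
  moreover have "closed M"
    unfolding M_def by (intro closed_Collect_eq f.continuous_on continuous_intros)
  ultimately obtain m where m: "m \<in> M" "\<And>y. y \<in> M \<Longrightarrow> cinner (v - m) y = 0"
    using ex_orthogonal_projection by blast
  define w where "w = v - m"
  have fw: "f w \<noteq> 0" using v m(1) by (simp add: w_def f.diff M_def)
  then have "w \<noteq> 0" by (auto simp: f.zero)
  show ?thesis
  proof (rule that[of "cnj (f w / (norm w)\<^sup>2) *\<^sub>C w"])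
    fix x
    have "x - (f x / f w) *\<^sub>C w \<in> M" using fw by (simp add: M_def f.diff scale)
    then have "cinner (x - (f x / f w) *\<^sub>C w) w = 0"
      using m(2) cinner.hermitian by (metis complex_cnj_zero w_def)
    then have "cinner x w = f x / f w * of_real ((norm w)\<^sup>2)"
      by (simp only: cinner.expand cinner_self_eq_norm) simp
    then show "f x = cinner x (cnj (f w / (norm w)\<^sup>2) *\<^sub>C w)"
      using fw \<open>w \<noteq> 0\<close> by (simp add: cinner.expand)
  qed
qed

lemma bounded_clinearI:
  assumes "\<And>x y. T (x + y) = T x + T y" "\<And>c x. T (c *\<^sub>C x) = c *\<^sub>C T x"
    and "\<And>x. norm (T x) \<le> norm x * K"
  shows "bounded_clinear (T :: 'a::chilbert_space \<Rightarrow> 'a)"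
  unfolding bounded_clinear_def using assms
  by (auto intro!: bounded_linear_intro simp: scaleR_scaleC)

lemma
  assumes "bounded_clinear T"
  shows bounded_clinear_bounded_linear: "bounded_linear T"
    and bounded_clinear_scaleC: "T (c *\<^sub>C x) = c *\<^sub>C T x"
    and bounded_clinear_add: "T (x + y) = T x + T y"
    and bounded_clinear_diff: "T (x - y) = T x - T y"
    and bounded_clinear_zero: "T 0 = 0"
  using assms unfolding bounded_clinear_def
  by (simp_all add: linear_simps)

lemma bounded_clinear_comp:
  "bounded_clinear S \<Longrightarrow> bounded_clinear T \<Longrightarrow> bounded_clinear (\<lambda>x. S (T x))"
  unfolding bounded_clinear_def by (auto intro: bounded_linear_compose)

text \<open>Riesz representation gives \<open>S y\<close> for each \<open>y\<close>; linearity
  follows by testing against all vectors.\<close>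

lemma ex1_adjoint:
  assumes "bounded_clinear T"
  shows "\<exists>!S. bounded_clinear S \<and> (\<forall>x y. cinner (T x) y = cinner x (S y))"
proof (rule ex_ex1I)
  interpret T: bounded_linear T by (rule bounded_clinear_bounded_linear[OF assms])
  note scale = bounded_clinear_scaleC[OF assms]
  have "\<exists>z. \<forall>x. cinner (T x) y = cinner x z" for y
  proof -
    have "bounded_linear (\<lambda>x. cinner (T x) y)"
      by (rule bounded_linear_compose[OF bounded_linear_cinner_left T.bounded_linear_axioms])
    then show ?thesis
      using Riesz_representation[of "\<lambda>x. cinner (T x) y"] by (metis cinner.scaleC_left scale)
  qed
  then obtain S where S: "\<And>x y. cinner (T x) y = cinner x (S y)" by metis
  obtain K where K: "\<And>x. norm (T x) \<le> norm x * K" using T.bounded by blast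
  have "bounded_clinear S"
  proof (rule bounded_clinearI)
    show "S (x + y) = S x + S y" for x y
      by (rule cinner_eqI') (simp add: S[symmetric] cinner.expand)
    show "S (c *\<^sub>C x) = c *\<^sub>C S x" for c x
      by (rule cinner_eqI') (simp add: S[symmetric] cinner.expand)
    fix y
    \<comment> \<open>Taking \<open>S y\<close> itself as test vector leaves one factor
      \<open>norm (S y)\<close> to cancel, so \<open>S\<close> inherits the constant of
      \<open>T\<close>.\<close>
    have "(norm (S y))\<^sup>2 = cmod (cinner (T (S y)) y)"
      by (simp add: S cinner_self_eq_norm norm_power)
    also have "\<dots> \<le> norm (S y) * K * norm y"
      using cinner.Cauchy_Schwarz[of "T (S y)" y] K[of "S y"] by (meson mult_right_mono norm_ge_zero order_trans)
    finally have "norm (S y) * norm (S y) \<le> norm (S y) * (norm y * K)"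
      by (simp add: power2_eq_square ac_simps)
    \<comment> \<open>The sign of \<open>K\<close> is not given; the bound on \<open>T\<close> at
      \<open>y\<close> supplies what is needed.\<close>
    moreover have "0 \<le> norm y * K" if "norm (S y) = 0"
      using K[of y] norm_ge_zero order_trans by blast
    ultimately show "norm (S y) \<le> norm y * K"
      by (cases "norm (S y) = 0") (auto simp: mult_le_cancel_left_pos)
  qed
  with S show "\<exists>S. bounded_clinear S \<and> (\<forall>x y. cinner (T x) y = cinner x (S y))" by blast
  fix S S'
  assume S: "bounded_clinear S \<and> (\<forall>x y. cinner (T x) y = cinner x (S y))"
    and S': "bounded_clinear S' \<and> (\<forall>x y. cinner (T x) y = cinner x (S' y))"
  show "S = S'"
  proof
    fix y
    show "S y = S' y"
    proof (rule cinner_eqI')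
      fix x
      have "cinner (T x) y = cinner x (S y)" using S by blast
      moreover have "cinner (T x) y = cinner x (S' y)" using S' by blast
      ultimately show "cinner x (S y) = cinner x (S' y)" by simp
    qed
  qed
qed

lemma
  assumes "bounded_clinear T"
  shows bounded_clinear_adjoint_op: "bounded_clinear (adjoint_op T)"
    and cinner_adjoint_op: "cinner (T x) y = cinner x (adjoint_op T y)"
  using theI'[OF ex1_adjoint[OF assms]] unfolding adjoint_op_def by blast+

text \<open>The closed level sets exhaust the complete space, so by Baire one contains a ball.
  Differences from its centre bound \<open>X\<close> near 0 (hence the factor 2), and scaling
  \<open>y\<close> to norm \<open>r / 2\<close> bounds it everywhere.\<close>

lemma bounded_linear_if_closed_levels:
  fixes X :: "'a::banach \<Rightarrow> 'b::real_normed_vector"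
  assumes "linear X" and closed: "\<And>n::nat. closed {y. norm (X y) \<le> n}"
  shows "bounded_linear X"
proof -
  interpret X: linear X by fact
  define E where "E n = {y. norm (X y) \<le> real n}" for n
  have "\<exists>n. interior (E n) \<noteq> {}"
  proof (rule ccontr)
    assume "\<not> ?thesis"
    then have "Met_TC.mtopology interior_of \<Union> (range E) = {}"
      using closed by (intro Met_TC.metric_Baire_category_alt)
        (auto simp: E_def complete_UNIV)
    moreover have "\<Union> (range E) = UNIV"
      using real_arch_simple by (auto simp: E_def)
    ultimately show False by simp
  qed
  then obtain n y0 where "y0 \<in> interior (E n)" by blast
  then obtain r where r: "r > 0" "ball y0 r \<subseteq> E n" by (auto simp: mem_interior)
  have small: "norm (X h) \<le> 2 * n" if "norm h < r" for h
  proof -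
    have "y0 \<in> E n" "y0 + h \<in> E n" using r that by (auto simp: dist_norm)
    then have "norm (X (y0 + h) - X y0) \<le> n + n"
      using norm_triangle_ineq4[of "X (y0 + h)" "X y0"] by (simp add: E_def)
    then show ?thesis by (simp add: X.add)
  qed
  show ?thesis
  proof (rule bounded_linear_intro)
    fix y
    show "norm (X y) \<le> norm y * (4 * n / r)"
    proof (cases "y = 0")
      case False
      have "norm (X ((r / (2 * norm y)) *\<^sub>R y)) \<le> 2 * n"
        using r(1) False by (intro small) simp
      then show ?thesis
        using r(1) False by (simp add: X.scaleR field_simps)
    qed (simp add: X.zero)
  qed (simp_all add: X.add X.scaleR)
qed

section \<open>Operators on a semi-Hilbertian space\<close>

context positive_form
begin

text \<open>With \<open>a n = seminorm (S\<^sup>n x)\<close>, symmetry makes \<open>a\<close> log-convex, so \<open>a 1 > M * a 0\<close> would force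
  geometric growth at a rate above \<open>M\<close>, against \<open>a n \<le> C * M\<^sup>n * norm x\<close>.\<close>

lemma symmetric_imp_seminorm_bounded:
  assumes "\<And>x. seminorm x \<le> C * norm x"
    and M: "\<And>x. norm (S x) \<le> M * norm x" "0 < M"
    and symmetric: "\<And>x y. p (S x) y = p x (S y)"
  shows "seminorm (S x) \<le> M * seminorm x"
proof (rule ccontr)
  assume contra: "\<not> ?thesis"
  define a where "a n = seminorm ((S ^^ n) x)" for n
  define r where "r = a 1 / a 0"
  have log_convex: "(a (Suc n))\<^sup>2 \<le> a n * a (Suc (Suc n))" for n
  proof -
    have "(a (Suc n))\<^sup>2 = cmod (p (S ((S ^^ n) x)) (S ((S ^^ n) x)))"
      by (simp add: a_def diag norm_power)
    also have "\<dots> = cmod (p ((S ^^ n) x) (S (S ((S ^^ n) x))))"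
      by (simp only: symmetric)
    also have "\<dots> \<le> a n * a (Suc (Suc n))"
      using Cauchy_Schwarz by (simp add: a_def)
    finally show ?thesis .
  qed
  have a1: "a 1 > M * a 0" using contra by (simp add: a_def)
  have a0: "a 0 > 0"
  proof (rule ccontr)
    assume "\<not> a 0 > 0"
    then have "a 0 = 0" using seminorm_nonneg[of x] by (simp add: a_def)
    then show False using log_convex[of 0] a1 by simp
  qed
  have r: "r > M" using a0 a1 by (simp add: r_def pos_less_divide_eq)
  \<comment> \<open>Log-convexity means that successive ratios never fall below the first one,
    \<open>r\<close>. Positivity is carried along so that \<open>a n\<close> can be
    cancelled.\<close>
  have step: "a n > 0 \<and> r * a n \<le> a (Suc n)" for n
  proof (induction n)
    case 0
    then show ?case using a0 by (simp add: r_def)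
  next
    case (Suc n)
    then have pos: "a (Suc n) > 0"
      using r M(2) by (meson less_le_trans mult_pos_pos order_less_trans)
    have "a n * (r * a (Suc n)) \<le> a (Suc n) * a (Suc n)"
      using mult_right_mono[of "r * a n" "a (Suc n)" "a (Suc n)"] Suc pos by (simp add: ac_simps)
    also have "\<dots> \<le> a n * a (Suc (Suc n))"
      using log_convex[of n] by (simp add: power2_eq_square)
    finally show ?case using Suc pos by simp
  qed
  have growth: "r ^ n * a 0 \<le> a n" for n
  proof (induction n)
    case (Suc n)
    have "r ^ Suc n * a 0 \<le> r * a n"
      using Suc r M(2) by (simp add: mult.assoc)
    also have "\<dots> \<le> a (Suc n)" using step by blast
    finally show ?case .
  qed simp
  have "norm ((S ^^ n) x) \<le> M ^ n * norm x" for n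
  proof (induction n)
    case (Suc n)
    have "norm ((S ^^ Suc n) x) \<le> M * norm ((S ^^ n) x)" using M(1) by simp
    also have "\<dots> \<le> M * (M ^ n * norm x)" using Suc M(2) by simp
    finally show ?case by (simp add: mult.assoc)
  qed simp
  then have upper: "a n \<le> \<bar>C\<bar> * (M ^ n * norm x)" for n
    unfolding a_def using assms(1)[of "(S ^^ n) x"]
    by (meson abs_ge_self abs_ge_zero mult_mono norm_ge_zero order_trans)
  obtain n where "\<bar>C\<bar> * norm x / a 0 < (r / M) ^ n"
    using real_arch_pow[of "r / M"] r M(2) by (auto simp: less_divide_eq)
  then have "\<bar>C\<bar> * norm x * M ^ n < r ^ n * a 0"
    using a0 M(2) by (simp add: power_divide field_simps)
  then show False
    using growth[of n] upper[of n] by (simp add: ac_simps)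
qed

end

section \<open>The form of a positive operator and its adjoints\<close>

lemma positive_form_A_inner:
  assumes "positive_op A"
  shows "positive_form (A_inner A)"
proof -
  have A: "bounded_clinear A" using assms by (simp add: positive_op_def)
  show ?thesis
    using assms
    by unfold_locales
      (simp_all add: A_inner_def positive_op_def cinner.expand bounded_clinear_add[OF A] bounded_clinear_scaleC[OF A])
qed

lemma seminorm_A_inner: "positive_op A \<Longrightarrow> positive_form.seminorm (A_inner A) = A_norm A"
  by (simp add: fun_eq_iff A_norm_def positive_form.seminorm_def[OF positive_form_A_inner])

lemma positive_op_symmetric:
  assumes "positive_op A"
  shows "cinner (A x) y = cinner x (A y)"
proof -
  have "cinner (A x) y = cnj (cinner (A y) x)"
    using positive_form.hermitian[OF positive_form_A_inner[OF assms], of x y] by (simp add: A_inner_def)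
  then show ?thesis by (simp flip: cinner.hermitian[of x "A y"])
qed

lemma csubspace_range:
  assumes "bounded_clinear A"
  shows "csubspace (range A)"
  unfolding csubspace_def
  using bounded_clinear_zero[OF assms] bounded_clinear_add[OF assms] bounded_clinear_scaleC[OF assms]
  by (auto simp: image_iff) metis+

text \<open>By continuity the estimate extends to all \<open>z\<close> in \<open>closure S\<close>,
  in particular to \<open>z = u\<close>. For \<open>n = 0\<close> it says that a vector of the
  closure orthogonal to \<open>S\<close> vanishes.\<close>

lemma norm_le_on_closure:
  assumes "u \<in> closure S" "\<And>z. z \<in> S \<Longrightarrow> cmod (cinner (u::'a::chilbert_space) z) \<le> n * norm z"
    and "0 \<le> n"
  shows "norm u \<le> n"
proof -
  have "closed {z. cmod (cinner u z) \<le> n * norm z}"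
    by (intro closed_Collect_le continuous_intros bounded_linear.continuous_on[OF bounded_linear_cinner_right])
  then have "closure S \<subseteq> {z. cmod (cinner u z) \<le> n * norm z}"
    using assms(2) by (intro closure_minimal) auto
  then have "cmod (cinner u u) \<le> n * norm u"
    using assms(1) by blast
  then have "norm u * norm u \<le> n * norm u"
    unfolding cinner_self_eq_norm norm_of_real by (simp add: power2_eq_square)
  then show ?thesis
    using \<open>0 \<le> n\<close> by (cases "u = 0") auto
qed

text \<open>\<open>A\<close> maps \<open>closure (range A)\<close> injectively onto \<open>range A\<close>, and \<open>X y\<close> is the preimage of
  \<open>adjoint_op T (A y)\<close>. The level sets \<open>norm (X y) \<le> n\<close> are closed because they are cut out by the
  conditions \<open>\<bar>cinner y (A (T v))\<bar> \<le> n * norm (A v)\<close>.\<close>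

lemma ex1_A_sharp:
  assumes pos: "positive_op A" and T: "T \<in> B_A A"
  shows "\<exists>!X. bounded_clinear X \<and> A \<circ> X = adjoint_op T \<circ> A \<and> range X \<subseteq> closure (range A)"
proof (rule ex_ex1I)
  have A: "bounded_clinear A" using pos by (simp add: positive_op_def)
  have bT: "bounded_clinear T" and rT: "range (adjoint_op T \<circ> A) \<subseteq> range A"
    using T by (auto simp: B_A_def)
  note sym = positive_op_symmetric[OF pos]
  note adj = cinner_adjoint_op[OF bT]
  note bT' = bounded_clinear_adjoint_op[OF bT]
  define R where "R = closure (range A)"
  have R: "csubspace R" "closed R"
    using csubspace_closure[OF csubspace_range[OF A]] by (simp_all add: R_def)
  have A_R: "A v \<in> R" for v unfolding R_def by (rule subsetD[OF closure_subset rangeI])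
  \<comment> \<open>\<open>A\<close> kills \<open>u - v\<close>, so by symmetry \<open>u - v\<close>
    is orthogonal to \<open>range A\<close>, although it lies in the closure of that range.\<close>
  have unique: "u = v" if "u \<in> R" "v \<in> R" "A u = A v" for u v
  proof -
    have "u - v \<in> R" using csubspace_diff[OF R(1)] that by blast
    moreover have "cinner (u - v) (A z) = 0" for z
      using that(3) by (simp add: sym[symmetric] bounded_clinear_diff[OF A])
    ultimately have "norm (u - v) \<le> 0"
      unfolding R_def by (intro norm_le_on_closure[of _ "range A" 0]) auto
    then show ?thesis by simp
  qed
  have "\<exists>u\<in>R. A u = adjoint_op T (A y)" for y
  proof -
    obtain z where z: "A z = adjoint_op T (A y)" using rT by (auto simp: image_subset_iff image_iff) metis
    \<comment> \<open>Projecting a preimage onto \<open>R\<close> does not change its image: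
      \<open>z - u\<close> is orthogonal to \<open>range A\<close>, hence in the kernel of
      \<open>A\<close>.\<close>
    obtain u where u: "u \<in> R" "\<And>v. v \<in> R \<Longrightarrow> cinner (z - u) v = 0"
      using ex_orthogonal_projection[OF R] by blast
    have "A (z - u) = 0"
    proof (rule cinner_eqI)
      show "cinner (A (z - u)) v = cinner 0 v" for v
        using u(2)[OF A_R] by (simp add: sym)
    qed
    then show ?thesis using u(1) z by (intro bexI[of _ u]) (simp_all add: bounded_clinear_diff[OF A])
  qed
  then obtain X where X: "\<And>y. X y \<in> R" "\<And>y. A (X y) = adjoint_op T (A y)" by metis
  have add: "X (x + y) = X x + X y" for x y
    by (rule unique) (use X R(1) in \<open>simp_all add: csubspace_def bounded_clinear_add[OF A] bounded_clinear_add[OF bT']\<close>)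
  have scale: "X (c *\<^sub>C x) = c *\<^sub>C X x" for c x
    by (rule unique) (use X R(1) in \<open>simp_all add: csubspace_def bounded_clinear_scaleC[OF A] bounded_clinear_scaleC[OF bT']\<close>)
  \<comment> \<open>The right side is continuous in \<open>y\<close> without any knowledge of the
    continuity of \<open>X\<close>.\<close>
  have weak: "cinner (X y) (A v) = cinner y (A (T v))" for y v
  proof -
    have "cinner (X y) (A v) = cinner (adjoint_op T (A y)) v" by (simp add: sym[symmetric] X(2))
    also have "\<dots> = cnj (cinner (T v) (A y))" by (simp add: adj flip: cinner.hermitian)
    also have "\<dots> = cinner y (A (T v))" by (simp add: sym flip: cinner.hermitian)
    finally show ?thesis .
  qed
  have "bounded_linear X"
  proof (rule bounded_linear_if_closed_levels)
    show "linear X" by (rule linearI) (simp_all add: add scale scaleR_scaleC)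
    fix n :: nat
    have "norm (X y) \<le> n \<longleftrightarrow> (\<forall>v. cmod (cinner y (A (T v))) \<le> n * norm (A v))" for y
    proof
      assume "norm (X y) \<le> n"
      then show "\<forall>v. cmod (cinner y (A (T v))) \<le> n * norm (A v)"
        unfolding weak[symmetric] by (meson cinner.Cauchy_Schwarz mult_right_mono norm_ge_zero order_trans)
    next
      assume "\<forall>v. cmod (cinner y (A (T v))) \<le> n * norm (A v)"
      then show "norm (X y) \<le> n"
        unfolding weak[symmetric] using X(1)[of y] unfolding R_def
        by (intro norm_le_on_closure[of _ "range A" n]) auto
    qed
    then show "closed {y. norm (X y) \<le> n}"
      by (simp only:) (intro closed_Collect_all closed_Collect_le continuous_intros
        bounded_linear.continuous_on[OF bounded_linear_cinner_left])
  qed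
  then have "bounded_clinear X" using scale by (simp add: bounded_clinear_def)
  then show "\<exists>X. bounded_clinear X \<and> A \<circ> X = adjoint_op T \<circ> A \<and> range X \<subseteq> closure (range A)"
    using X unfolding R_def by (intro exI[of _ X]) (auto simp: fun_eq_iff)
  fix X Y
  assume "bounded_clinear X \<and> A \<circ> X = adjoint_op T \<circ> A \<and> range X \<subseteq> closure (range A)"
    and "bounded_clinear Y \<and> A \<circ> Y = adjoint_op T \<circ> A \<and> range Y \<subseteq> closure (range A)"
  then have "X y \<in> R" "Y y \<in> R" "(A \<circ> X) y = (A \<circ> Y) y" for y
    by (auto simp: R_def)
  then show "X = Y" using unique by (auto simp: fun_eq_iff)
qed

lemma
  assumes "positive_op A" and T: "T \<in> B_A A"
  shows bounded_clinear_A_sharp: "bounded_clinear (A_sharp A T)"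
    and A_inner_A_sharp: "A_inner A (T x) y = A_inner A x (A_sharp A T y)"
proof -
  have X: "bounded_clinear (A_sharp A T)" "A \<circ> A_sharp A T = adjoint_op T \<circ> A"
    using theI'[OF ex1_A_sharp[OF assms]] unfolding A_sharp_def by blast+
  show "bounded_clinear (A_sharp A T)" by fact
  have "bounded_clinear T" using T by (simp add: B_A_def)
  then have "A_inner A (T x) y = cinner x (adjoint_op T (A y))"
    by (simp add: A_inner_def positive_op_symmetric[OF assms(1)] cinner_adjoint_op)
  also have "\<dots> = cinner x (A (A_sharp A T y))" using fun_cong[OF X(2), of y] by simp
  finally show "A_inner A (T x) y = A_inner A x (A_sharp A T y)"
    by (simp add: A_inner_def positive_op_symmetric[OF assms(1)])
qed

text \<open>The product of the sharp operator and \<open>T\<close> is symmetric for the form, so its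
  norm bound passes to the seminorm. This bounds \<open>T\<close> through its square, and then the
  sharp operator by duality. The resulting \<open>M\<close> makes the suprema below finite.\<close>

lemma A_norm_le_mult:
  assumes pos: "positive_op A" and T: "T \<in> B_A A"
  obtains M where "0 \<le> M" "\<And>x. A_norm A (T x) \<le> M * A_norm A x"
    "\<And>x. A_norm A (A_sharp A T x) \<le> M * A_norm A x"
proof -
  interpret positive_form "A_inner A" by (rule positive_form_A_inner[OF pos])
  note seminorm = seminorm_A_inner[OF pos]
  note sharp = A_inner_A_sharp[OF pos T]
  define X where "X = A_sharp A T"
  have bT: "bounded_clinear T" using T by (simp add: B_A_def)
  have bX: "bounded_clinear X" unfolding X_def by (rule bounded_clinear_A_sharp[OF pos T])
  have XT: "A_inner A (X (T x)) y = A_inner A x (X (T y))" for x y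
    using sharp hermitian by (metis X_def)
  obtain K where K: "0 < K" "\<And>x. norm (X (T x)) \<le> norm x * K"
    using bounded_linear.pos_bounded[OF bounded_clinear_bounded_linear[OF bounded_clinear_comp[OF bX bT]]]
    by blast
  have "bounded_linear A" using pos by (simp add: positive_op_def bounded_clinear_def)
  then obtain C where C: "0 < C" "\<And>x. norm (A x) \<le> norm x * C"
    using bounded_linear.pos_bounded by blast
  have "seminorm x \<le> sqrt C * norm x" for x
  proof -
    have "Re (A_inner A x x) \<le> norm (A x) * norm x"
      using complex_Re_le_cmod cinner.Cauchy_Schwarz order_trans unfolding A_inner_def by blast
    also have "\<dots> \<le> (norm x * C) * norm x" using C by (intro mult_right_mono) auto
    also have "\<dots> = (sqrt C * norm x)\<^sup>2"
      using C(1) by (simp add: power_mult_distrib) (simp add: power2_eq_square)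
    finally have "(seminorm x)\<^sup>2 \<le> (sqrt C * norm x)\<^sup>2" by (simp only: seminorm_power2)
    then show ?thesis
      using C(1) by (auto intro: power2_le_imp_le)
  qed
  from symmetric_imp_seminorm_bounded[OF this, of "\<lambda>x. X (T x)" K] K XT
  have XT_le: "seminorm (X (T x)) \<le> K * seminorm x" for x
    by (simp add: mult.commute)
  have T_le: "seminorm (T x) \<le> sqrt K * seminorm x" for x
  proof -
    have "(seminorm (T x))\<^sup>2 = cmod (A_inner A x (X (T x)))"
      unfolding X_def sharp[symmetric] by (simp add: diag norm_power)
    also have "\<dots> \<le> seminorm x * (K * seminorm x)"
      using Cauchy_Schwarz XT_le by (meson mult_left_mono order_trans seminorm_nonneg)
    also have "\<dots> = (sqrt K * seminorm x)\<^sup>2"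
      using K(1) by (simp add: power_mult_distrib) (simp add: power2_eq_square)
    finally show ?thesis
      using K(1) by (auto intro: power2_le_imp_le)
  qed
  have X_le: "seminorm (X x) \<le> sqrt K * seminorm x" for x
  proof (cases "seminorm (X x) = 0")
    case True
    then show ?thesis using K(1) by simp
  next
    case False
    have "(seminorm (X x))\<^sup>2 = cmod (A_inner A (T (X x)) x)"
      unfolding sharp by (simp add: diag norm_power flip: X_def)
    also have "\<dots> \<le> (sqrt K * seminorm (X x)) * seminorm x"
      using Cauchy_Schwarz T_le by (meson mult_right_mono order_trans seminorm_nonneg)
    finally have "seminorm (X x) * seminorm (X x) \<le> seminorm (X x) * (sqrt K * seminorm x)"
      by (simp only: power2_eq_square ac_simps)
    moreover have "0 < seminorm (X x)" using False seminorm_nonneg[of "X x"] by linarith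
    ultimately show ?thesis by (rule mult_left_le_imp_le)
  qed
  show thesis
    using that[of "sqrt K"] T_le X_le K(1) by (simp add: seminorm X_def)
qed

text \<open>\<open>K\<close> serves only to witness that the supremum is over a bounded set; its
  size does not enter the conclusion.\<close>

lemma A_inner_le_numerical_radius:
  assumes "\<And>x. A_norm A x = 1 \<Longrightarrow> cmod (A_inner A (V x) x) \<le> K" and "A_norm A x = 1"
  shows "cmod (A_inner A (V x) x) \<le> A_numerical_radius A V"
  unfolding A_numerical_radius_def using assms by (intro cSUP_upper bdd_aboveI[of _ K]) auto

lemma Crawford_number_le_A_inner:
  assumes "A_norm A x = 1"
  shows "A_Crawford_number A V \<le> cmod (A_inner A (V x) x)"
  unfolding A_Crawford_number_def using assms by (intro cINF_lower bdd_belowI[of _ 0]) auto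

lemma Crawford_number_nonneg:
  assumes "\<exists>x. A_norm A x = 1"
  shows "0 \<le> A_Crawford_number A V"
  unfolding A_Crawford_number_def using assms by (intro cINF_greatest) auto

section \<open>The Davis-Wielandt estimate\<close>

theorem theorem2p12:
  fixes A T :: "'a::chilbert_space \<Rightarrow> 'a"
  assumes "positive_op A" and "A \<noteq> (\<lambda>x. 0)"
    and "T \<in> B_A A"
  shows "let w = A_numerical_radius A; c = A_Crawford_number A T;
             \<mu> = (w T)\<^sup>2 * (2 * (w T)\<^sup>2 - c\<^sup>2 + 2 * w T * sqrt ((w T)\<^sup>2 - c\<^sup>2))
         in A_Davis_Wielandt_radius A T
              \<le> sqrt 2 / 2 * sqrt (w (T ^^ 2)
                  + 1 / 2 * w (\<lambda>x. A_sharp A T (T x) + T (A_sharp A T x)) + 8 * \<mu>)"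
proof -
  note pos = assms(1)
  interpret positive_form "A_inner A"
    rewrites "positive_form.seminorm (A_inner A) = A_norm A"
    by (rule positive_form_A_inner[OF pos]) (rule seminorm_A_inner[OF pos])
  define X where "X = A_sharp A T"
  have sharp: "A_inner A (T x) y = A_inner A x (X y)" for x y
    unfolding X_def by (rule A_inner_A_sharp[OF pos assms(3)])
  have sharp': "A_inner A (X x) y = A_inner A x (T y)" for x y
    using sharp[of y x] hermitian by metis
  have bT: "bounded_clinear T" using assms(3) by (simp add: B_A_def)
  obtain M where M: "0 \<le> M" "\<And>x. A_norm A (T x) \<le> M * A_norm A x"
    "\<And>x. A_norm A (X x) \<le> M * A_norm A x"
    using A_norm_le_mult[OF pos assms(3)] unfolding X_def by blast
  \<comment> \<open>Ensures that the supremum and infimum range over a nonempty set;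
    \<open>A z\<close> paired with \<open>z\<close> has a nonzero value as soon as
    \<open>A z\<close> is nonzero.\<close>
  have unit: "\<exists>x. A_norm A x = 1"
  proof -
    obtain z where "A z \<noteq> 0" using assms(2) by auto
    then have "A_inner A z (A z) \<noteq> 0" by (simp add: A_inner_def cinner_self_eq_norm)
    then show ?thesis by (rule ex_unit)
  qed
  define V where "V x = X (T x) + T (X x)" for x
  define w where "w = A_numerical_radius A T"
  define c where "c = A_Crawford_number A T"
  define s where "s = sqrt (w\<^sup>2 - c\<^sup>2)"
  have V: "A_inner A (V x) x = of_real ((A_norm A (T x))\<^sup>2 + (A_norm A (X x))\<^sup>2)" for x
    by (simp add: V_def expand sharp' sharp diag)
  have T_le: "cmod (A_inner A (T x) x) \<le> w" if "A_norm A x = 1" for x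
    unfolding w_def
  proof (rule A_inner_le_numerical_radius[OF _ that])
    show "cmod (A_inner A (T x) x) \<le> M" if "A_norm A x = 1" for x
      using Cauchy_Schwarz[of "T x" x] M(2)[of x] that by simp
  qed
  have T2_le: "cmod (A_inner A (T (T x)) x) \<le> A_numerical_radius A (T ^^ 2)" if "A_norm A x = 1" for x
  proof -
    have "cmod (A_inner A ((T ^^ 2) x) x) \<le> M * M" if "A_norm A x = 1" for x
      using Cauchy_Schwarz[of "T (T x)" x] M(2)[of "T x"] mult_left_mono[OF M(2)[of x] M(1)] that
      by (simp add: numeral_2_eq_2)
    from A_inner_le_numerical_radius[OF this \<open>A_norm A x = 1\<close>] show ?thesis
      by (simp add: numeral_2_eq_2 comp_def)
  qed
  have V_le: "(A_norm A (T x))\<^sup>2 + (A_norm A (X x))\<^sup>2 \<le> A_numerical_radius A V" if "A_norm A x = 1" for x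
  proof -
    have "cmod (A_inner A (V x) x) \<le> M\<^sup>2 + M\<^sup>2" if "A_norm A x = 1" for x
    proof -
      have "(A_norm A (T x))\<^sup>2 \<le> M\<^sup>2" "(A_norm A (X x))\<^sup>2 \<le> M\<^sup>2"
        using M(2)[of x] M(3)[of x] that by (simp_all add: power_mono)
      then show ?thesis unfolding V norm_of_real by simp
    qed
    from A_inner_le_numerical_radius[OF this \<open>A_norm A x = 1\<close>] show ?thesis
      unfolding V norm_of_real by simp
  qed
  have c: "0 \<le> c" "c \<le> w"
    using unit Crawford_number_nonneg[OF unit] Crawford_number_le_A_inner T_le
    unfolding c_def by (blast, meson order_trans)
  have "c\<^sup>2 \<le> w\<^sup>2" using c by (intro power_mono)
  then have s: "0 \<le> s" "s\<^sup>2 = w\<^sup>2 - c\<^sup>2" by (simp_all add: s_def)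
  have "s \<le> w"
    using s c by (auto intro: power2_le_imp_le)
  define q where "q x y = A_inner A (T x) y" for x y
  have q: "sesquilinear_form q"
    by unfold_locales (simp_all add: q_def expand bounded_clinear_add[OF bT] bounded_clinear_scaleC[OF bT])
  have "cmod (q x x) \<le> w * (A_norm A x)\<^sup>2" for x
  proof (rule homogeneous_le)
    interpret q: sesquilinear_form q by (rule q)
    show "cmod (q (r *\<^sub>R x) (r *\<^sub>R x)) = r\<^sup>2 * cmod (q x x)" for r x
      by (simp add: q.expand norm_mult power2_eq_square flip: mult.assoc)
    show "cmod (q x x) \<le> w" if "A_norm A x = 1" for x
      using T_le[OF that] by (simp add: q_def)
    show "cmod (q x x) \<le> 0" if "A_norm A x = 0" for x
      using Cauchy_Schwarz_zero[OF that] by (simp add: q_def)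
  qed
  moreover have "c \<le> cmod (q x x)" if "A_norm A x = 1" for x
    unfolding c_def q_def by (rule Crawford_number_le_A_inner[OF that])
  ultimately have q_le: "cmod (q x y) \<le> (w + s) * A_norm A x * A_norm A y" for x y
    unfolding s_def using q c unit by (intro annulus_bound) auto
  \<comment> \<open>Put \<open>y = T x\<close> in \<open>q_le\<close> and cancel one factor
    \<open>A_norm A (T x)\<close>.\<close>
  have T_norm: "A_norm A (T x) \<le> w + s" if "A_norm A x = 1" for x
  proof (cases "A_norm A (T x) = 0")
    case False
    have "(A_norm A (T x))\<^sup>2 \<le> (w + s) * A_norm A (T x)"
      using q_le[of x "T x"] that by (simp add: q_def diag norm_power)
    then show ?thesis
      using False seminorm_nonneg[of "T x"] by (simp add: power2_eq_square mult_le_cancel_right)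
  qed (use c s in simp)
  define \<mu> where "\<mu> = w\<^sup>2 * (2 * w\<^sup>2 - c\<^sup>2 + 2 * w * s)"
  define B where "B = A_numerical_radius A (T ^^ 2) + 1 / 2 * A_numerical_radius A V + 8 * \<mu>"
  have "sqrt ((cmod (A_inner A (T x) x))\<^sup>2 + A_norm A (T x) ^ 4) \<le> sqrt 2 / 2 * sqrt B"
    if x: "A_norm A x = 1" for x
  proof -
    \<comment> \<open>Both factors equal \<open>A_inner A (T x) x\<close>; this writes the square in
      the shape of Buzano with unit vector \<open>x\<close>.\<close>
    have "(cmod (A_inner A (T x) x))\<^sup>2 = cmod (A_inner A (T x) x * A_inner A x (X x))"
      by (simp add: sharp norm_mult power2_eq_square)
    also have "\<dots> \<le> (cmod (A_inner A (T x) (X x)) + A_norm A (T x) * A_norm A (X x)) / 2"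
      by (rule Buzano[OF x])
    also have "A_inner A (T x) (X x) = A_inner A (T (T x)) x" by (simp add: sharp)
    finally have "(cmod (A_inner A (T x) x))\<^sup>2
        \<le> A_numerical_radius A (T ^^ 2) / 2 + A_norm A (T x) * A_norm A (X x) / 2"
      using T2_le[OF x] by simp
    also have "A_norm A (T x) * A_norm A (X x) / 2 \<le> ((A_norm A (T x))\<^sup>2 + (A_norm A (X x))\<^sup>2) / 4"
      using sum_squares_bound[of "A_norm A (T x)" "A_norm A (X x)"] by simp
    also have "\<dots> \<le> A_numerical_radius A V / 4"
      using V_le[OF x] by (intro divide_right_mono) simp_all
    finally have part1: "(cmod (A_inner A (T x) x))\<^sup>2
        \<le> A_numerical_radius A (T ^^ 2) / 2 + A_numerical_radius A V / 4"
      by simp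
    have "A_norm A (T x) ^ 4 \<le> (w + s) ^ 4"
      using T_norm[OF x] by (intro power_mono) simp_all
    also have "\<dots> = (w + s)\<^sup>2 * (w + s)\<^sup>2" by (simp flip: power_add)
    \<comment> \<open>Only one of the two squares is enlarged: the other, by
      \<open>s^2 = w^2 - c^2\<close>, is exactly the bracket in \<open>\<mu>\<close>.\<close>
    also have "\<dots> \<le> (2 * w)\<^sup>2 * (w + s)\<^sup>2"
      using \<open>s \<le> w\<close> c s by (intro mult_right_mono power_mono) simp_all
    also have "\<dots> = 4 * \<mu>"
      using s(2) by (simp add: \<mu>_def power2_sum power_mult_distrib)
    finally have "(cmod (A_inner A (T x) x))\<^sup>2 + A_norm A (T x) ^ 4 \<le> B / 2"
      using part1 by (simp add: B_def)
    then have "sqrt ((cmod (A_inner A (T x) x))\<^sup>2 + A_norm A (T x) ^ 4) \<le> sqrt (B / 2)"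
      by simp
    also have "\<dots> = sqrt 2 / 2 * sqrt B"
      by (simp add: real_sqrt_divide field_simps)
    finally show ?thesis .
  qed
  then have "A_Davis_Wielandt_radius A T \<le> sqrt 2 / 2 * sqrt B"
    unfolding A_Davis_Wielandt_radius_def using unit by (intro cSUP_least) auto
  then show ?thesis
    unfolding Let_def B_def \<mu>_def s_def w_def c_def V_def X_def .
qed

end
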